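(* Let $m,n,K$ be positive integers, $q=\min\{m,n\}$, $r\in\mathbb{R}$, and let $f:\Delta^q_+\to\mathbb{R}$ be a function whose lower-level sets $\{u\in\Delta^q_+\mid f(u)\le t\}$ are semidefinite-representable. Let $\bar S=\{M\in\mathcal{M}^{m,n}(\mathbb{R})\mid\mathrm{rank}(M)\le K,\ f(\sigma(M))\le r\}$. Then $\mathrm{conv}(\bar S)$ is semidefinite-representable.
   Context: $\Delta^q_+=\{x\in\mathbb{R}^q\mid x_1\ge\dots\ge x_q\ge0\}$. $\mathcal{M}^{m,n}(\mathbb{R})$ is the space of real $m\times n$ matrices and $\sigma(M)\in\mathbb{R}^q$ its vector of singular values in nonincreasing order. A set is semidefinite-representable if it is the projection of the solution set of a linear matrix inequality (i.e., of a set $\{(x,w)\mid A_0+\sum_i x_iA_i+\sum_j w_jB_j\succeq0\}$ with symmetric matrices $A_i,B_j$). *)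

theory Defs
  imports "HOL-Analysis.Analysis"
begin

text \<open>Vectors of R^d are represented as functions nat => real vanishing from index d on.\<close>

definition Rvec :: "nat \<Rightarrow> (nat \<Rightarrow> real) set" where
  "Rvec d = {x. \<forall>i\<ge>d. x i = 0}"

definition Delta_plus :: "nat \<Rightarrow> (nat \<Rightarrow> real) set" where
  "Delta_plus q = {x \<in> Rvec q. (\<forall>i j. i \<le> j \<longrightarrow> j < q \<longrightarrow> x j \<le> x i) \<and> (\<forall>i<q. 0 \<le> x i)}"

definition sym_mat :: "nat \<Rightarrow> (nat \<Rightarrow> nat \<Rightarrow> real) \<Rightarrow> bool" where
  "sym_mat N P \<longleftrightarrow> (\<forall>i<N. \<forall>j<N. P i j = P j i)"

definition psd_mat :: "nat \<Rightarrow> (nat \<Rightarrow> nat \<Rightarrow> real) \<Rightarrow> bool" where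
  "psd_mat N P \<longleftrightarrow> sym_mat N P \<and> (\<forall>v. 0 \<le> (\<Sum>i<N. \<Sum>j<N. v i * P i j * v j))"

definition sdr_vec :: "nat \<Rightarrow> (nat \<Rightarrow> real) set \<Rightarrow> bool" where
  "sdr_vec d S \<longleftrightarrow>
     (\<exists>N p A0 (A :: nat \<Rightarrow> nat \<Rightarrow> nat \<Rightarrow> real) (B :: nat \<Rightarrow> nat \<Rightarrow> nat \<Rightarrow> real).
        sym_mat N A0 \<and> (\<forall>k<d. sym_mat N (A k)) \<and> (\<forall>l<p. sym_mat N (B l)) \<and>
        S = {x \<in> Rvec d. \<exists>w. psd_mat N
               (\<lambda>i j. A0 i j + (\<Sum>k<d. x k * A k i j) + (\<Sum>l<p. w l * B l i j))})"

definition sdr :: "'a::euclidean_space set \<Rightarrow> bool" where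
  "sdr S \<longleftrightarrow>
     (\<exists>N p A0 (A :: 'a \<Rightarrow> nat \<Rightarrow> nat \<Rightarrow> real) (B :: nat \<Rightarrow> nat \<Rightarrow> nat \<Rightarrow> real).
        sym_mat N A0 \<and> (\<forall>b\<in>Basis. sym_mat N (A b)) \<and> (\<forall>l<p. sym_mat N (B l)) \<and>
        S = {x. \<exists>w. psd_mat N
               (\<lambda>i j. A0 i j + (\<Sum>b\<in>Basis. (x \<bullet> b) * A b i j) + (\<Sum>l<p. w l * B l i j))})"

definition outer :: "real^'m \<Rightarrow> real^'n \<Rightarrow> real^'n^'m" where
  "outer u v = (\<chi> i j. u $ i * v $ j)"

text \<open>Singular value vector sigma(M) in Delta^q_+, q = min m n, defined via the (thin)
  singular value decomposition M = sum_{k<q} s_k u_k v_k^T with orthonormal u_k, v_k.\<close>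
definition svals :: "real^'n^'m \<Rightarrow> (nat \<Rightarrow> real)" where
  "svals M = (THE s. s \<in> Delta_plus (min CARD('m) CARD('n)) \<and>
     (\<exists>(u :: nat \<Rightarrow> real^'m) (v :: nat \<Rightarrow> real^'n).
        (\<forall>k<min CARD('m) CARD('n). \<forall>l<min CARD('m) CARD('n).
            u k \<bullet> u l = (if k = l then 1 else 0) \<and> v k \<bullet> v l = (if k = l then 1 else 0)) \<and>
        M = (\<Sum>k<min CARD('m) CARD('n). s k *\<^sub>R outer (u k) (v k))))"

end

theory Submission
  imports Defs
begin

text \<open>
  Let \<open>D\<close> be the set of \<open>u \<in> \<Delta>\<^sup>q\<^sub>+\<close> with \<open>f u \<le> r\<close> and \<open>u\<^sub>i = 0\<close> beyond the \<open>K\<close>-th entry. The convex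
  hull consists of the matrices \<open>M\<close> for which some \<open>u \<in> D\<close> satisfies \<open>\<parallel>M\<parallel>\<^sub>k \<le> u\<^sub>1 + \<dots> + u\<^sub>k\<close> for
  every \<open>k \<le> q\<close>, where \<open>\<parallel>M\<parallel>\<^sub>k\<close> is the \<open>k\<close>-th Ky Fan norm, and epigraphs of Ky Fan norms are
  semidefinite-representable. For the nontrivial inclusion, fix \<open>u\<close>: the matrices with singular
  values \<open>u\<close> form a compact set, so a matrix \<open>M\<close> outside its convex hull is strictly separated from
  it by some \<open>C\<close>. If \<open>C = \<Sum> s\<^sub>i x\<^sub>i y\<^sub>i\<^sup>T\<close> is a singular value decomposition, summation by parts and
  the Ky Fan bounds show that \<open>\<Sum> u\<^sub>i x\<^sub>i y\<^sub>i\<^sup>T\<close> is on the wrong side of the separating hyperplane.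
\<close>

subsection \<open>Semidefinite-representable sets\<close>

lemma sum_lessThan_plus:
  fixes h :: "nat \<Rightarrow> real"
  shows "(\<Sum>l<a + b. h l) = (\<Sum>l<a. h l) + (\<Sum>l<b. h (a + l))"
  by (induction b) (auto simp: add.assoc)

lemma psd_mat_convex_combination:
  assumes "psd_mat N P" "psd_mat N Q" "0 \<le> a" "0 \<le> b"
  shows "psd_mat N (\<lambda>i j. a * P i j + b * Q i j)"
proof -
  have "(\<Sum>i<N. \<Sum>j<N. v i * (a * P i j + b * Q i j) * v j)
      = a * (\<Sum>i<N. \<Sum>j<N. v i * P i j * v j) + b * (\<Sum>i<N. \<Sum>j<N. v i * Q i j * v j)" for v
    by (simp add: sum_distrib_left sum.distrib[symmetric] algebra_simps)
  then show ?thesis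
    using assms by (auto simp: psd_mat_def sym_mat_def)
qed

section \<open>Block-diagonal matrices\<close>

definition block_diag :: "nat \<Rightarrow> (nat \<Rightarrow> nat \<Rightarrow> real) \<Rightarrow> (nat \<Rightarrow> nat \<Rightarrow> real) \<Rightarrow> nat \<Rightarrow> nat \<Rightarrow> real" where
  "block_diag N P Q i j =
     (if i < N \<and> j < N then P i j else if N \<le> i \<and> N \<le> j then Q (i - N) (j - N) else 0)"

lemma sym_mat_block_diag:
  assumes "sym_mat N1 P" "sym_mat N2 Q"
  shows "sym_mat (N1 + N2) (block_diag N1 P Q)"
  using assms by (auto simp: sym_mat_def block_diag_def)

lemma quadratic_form_block_diag:
  "(\<Sum>i<N1 + N2. \<Sum>j<N1 + N2. v i * block_diag N1 P Q i j * v j)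
     = (\<Sum>i<N1. \<Sum>j<N1. v i * P i j * v j)
       + (\<Sum>i<N2. \<Sum>j<N2. v (N1 + i) * Q i j * v (N1 + j))"
  by (simp add: sum_lessThan_plus block_diag_def)

text \<open>Merges two matrix inequalities into one, as intersections require. Test vectors
  supported on a single block isolate the quadratic form of that block.\<close>

lemma psd_mat_block_diag:
  "psd_mat (N1 + N2) (block_diag N1 P Q) \<longleftrightarrow> psd_mat N1 P \<and> psd_mat N2 Q"
proof
  assume L: "psd_mat (N1 + N2) (block_diag N1 P Q)"
  have 1: "0 \<le> (\<Sum>i<N1. \<Sum>j<N1. v i * P i j * v j)
       + (\<Sum>i<N2. \<Sum>j<N2. v (N1 + i) * Q i j * v (N1 + j))" for v
    using L unfolding psd_mat_def quadratic_form_block_diag by blast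
  have sym: "block_diag N1 P Q i j = block_diag N1 P Q j i" if "i < N1 + N2" "j < N1 + N2" for i j
    using L that by (simp add: psd_mat_def sym_mat_def)
  have "sym_mat N1 P"
    unfolding sym_mat_def
  proof (intro allI impI)
    fix i j assume "i < N1" "j < N1"
    then show "P i j = P j i"
      using sym[of i j] by (simp add: block_diag_def)
  qed
  moreover have "sym_mat N2 Q"
    unfolding sym_mat_def
  proof (intro allI impI)
    fix i j assume "i < N2" "j < N2"
    then show "Q i j = Q j i"
      using sym[of "N1 + i" "N1 + j"] by (simp add: block_diag_def)
  qed
  moreover have "0 \<le> (\<Sum>i<N1. \<Sum>j<N1. v i * P i j * v j)" for v
    using 1[of "\<lambda>i. if i < N1 then v i else 0"] by simp
  moreover have "0 \<le> (\<Sum>i<N2. \<Sum>j<N2. v i * Q i j * v j)" for v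
    using 1[of "\<lambda>i. if i < N1 then 0 else v (i - N1)"] by simp
  ultimately show "psd_mat N1 P \<and> psd_mat N2 Q"
    by (simp add: psd_mat_def)
next
  assume "psd_mat N1 P \<and> psd_mat N2 Q"
  then show "psd_mat (N1 + N2) (block_diag N1 P Q)"
    by (simp add: psd_mat_def sym_mat_block_diag quadratic_form_block_diag)
qed

text \<open>Used for one inclusion of the final equality: a convex set containing the given matrices
  contains their hull. The auxiliary variables \<open>w\<close> are combined with the same weights
  as the points.\<close>

lemma sdr_convex:
  assumes "sdr S"
  shows "convex S"
proof -
  obtain N p A0 and A :: "'a \<Rightarrow> nat \<Rightarrow> nat \<Rightarrow> real" and B :: "nat \<Rightarrow> nat \<Rightarrow> nat \<Rightarrow> real"
    where S: "S = {x. \<exists>w. psd_mat N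
               (\<lambda>i j. A0 i j + (\<Sum>b\<in>Basis. (x \<bullet> b) * A b i j) + (\<Sum>l<p. w l * B l i j))}"
    using assms unfolding sdr_def by blast
  show ?thesis
  proof (rule convexI)
    fix x y and s t :: real
    assume "x \<in> S" "y \<in> S" and st: "0 \<le> s" "0 \<le> t" "s + t = 1"
    then obtain w w' where
      w: "psd_mat N (\<lambda>i j. A0 i j + (\<Sum>b\<in>Basis. (x \<bullet> b) * A b i j) + (\<Sum>l<p. w l * B l i j))" and
      w': "psd_mat N (\<lambda>i j. A0 i j + (\<Sum>b\<in>Basis. (y \<bullet> b) * A b i j) + (\<Sum>l<p. w' l * B l i j))"
      by (auto simp: S)
    \<comment> \<open>The constant matrix carries total weight \<open>s + t = 1\<close>, so it can
      be shared out between the two points before regrouping.\<close>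
    have A0: "A0 i j = s * A0 i j + t * A0 i j" for i j
      using st by (simp flip: distrib_right)
    have "(\<lambda>i j. A0 i j + (\<Sum>b\<in>Basis. ((s *\<^sub>R x + t *\<^sub>R y) \<bullet> b) * A b i j)
             + (\<Sum>l<p. (s * w l + t * w' l) * B l i j))
        = (\<lambda>i j. s * (A0 i j + (\<Sum>b\<in>Basis. (x \<bullet> b) * A b i j) + (\<Sum>l<p. w l * B l i j))
           + t * (A0 i j + (\<Sum>b\<in>Basis. (y \<bullet> b) * A b i j) + (\<Sum>l<p. w' l * B l i j)))"
      by (intro ext, subst A0)
        (simp add: inner_add_left sum_distrib_left sum.distrib algebra_simps)
    with psd_mat_convex_combination[OF w w' st(1,2)]
    have "psd_mat N (\<lambda>i j. A0 i j + (\<Sum>b\<in>Basis. ((s *\<^sub>R x + t *\<^sub>R y) \<bullet> b) * A b i j)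
             + (\<Sum>l<p. (s * w l + t * w' l) * B l i j))"
      by simp
    then show "s *\<^sub>R x + t *\<^sub>R y \<in> S"
      unfolding S by (intro CollectI exI[of _ "\<lambda>l. s * w l + t * w' l"])
  qed
qed

lemma sdr_Int:
  assumes "sdr S" "sdr T"
  shows "sdr (S \<inter> T)"
proof -
  obtain N1 p1 C0 and C :: "'a \<Rightarrow> nat \<Rightarrow> nat \<Rightarrow> real" and D :: "nat \<Rightarrow> nat \<Rightarrow> nat \<Rightarrow> real"
    where sym1: "sym_mat N1 C0" "\<forall>b\<in>Basis. sym_mat N1 (C b)" "\<forall>l<p1. sym_mat N1 (D l)"
      and S: "S = {x. \<exists>w. psd_mat N1
               (\<lambda>i j. C0 i j + (\<Sum>b\<in>Basis. (x \<bullet> b) * C b i j) + (\<Sum>l<p1. w l * D l i j))}"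
    using assms(1) unfolding sdr_def by blast
  obtain N2 p2 E0 and E :: "'a \<Rightarrow> nat \<Rightarrow> nat \<Rightarrow> real" and F :: "nat \<Rightarrow> nat \<Rightarrow> nat \<Rightarrow> real"
    where sym2: "sym_mat N2 E0" "\<forall>b\<in>Basis. sym_mat N2 (E b)" "\<forall>l<p2. sym_mat N2 (F l)"
      and T: "T = {x. \<exists>w. psd_mat N2
               (\<lambda>i j. E0 i j + (\<Sum>b\<in>Basis. (x \<bullet> b) * E b i j) + (\<Sum>l<p2. w l * F l i j))}"
    using assms(2) unfolding sdr_def by blast
  define A0 where "A0 = block_diag N1 C0 E0"
  define A where "A = (\<lambda>b. block_diag N1 (C b) (E b))"
  \<comment> \<open>The auxiliary variables of the two descriptions must stay independent, so they
    are concatenated: the first \<open>p1\<close> act on the upper block only, the rest, shifted by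
    \<open>p1\<close>, on the lower block only.\<close>
  define B where "B = (\<lambda>l. if l < p1 then block_diag N1 (D l) (\<lambda>_ _. 0)
                            else block_diag N1 (\<lambda>_ _. 0) (F (l - p1)))"
  have zero: "sym_mat N (\<lambda>_ _. 0)" for N
    by (simp add: sym_mat_def)
  have eq: "(\<lambda>i j. A0 i j + (\<Sum>b\<in>Basis. (x \<bullet> b) * A b i j) + (\<Sum>l<p1 + p2. w l * B l i j))
     = block_diag N1
        (\<lambda>i j. C0 i j + (\<Sum>b\<in>Basis. (x \<bullet> b) * C b i j) + (\<Sum>l<p1. w l * D l i j))
        (\<lambda>i j. E0 i j + (\<Sum>b\<in>Basis. (x \<bullet> b) * E b i j) + (\<Sum>l<p2. w (p1 + l) * F l i j))" for x w
  proof (intro ext)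
    fix i j
    show "A0 i j + (\<Sum>b\<in>Basis. (x \<bullet> b) * A b i j) + (\<Sum>l<p1 + p2. w l * B l i j)
     = block_diag N1
        (\<lambda>i j. C0 i j + (\<Sum>b\<in>Basis. (x \<bullet> b) * C b i j) + (\<Sum>l<p1. w l * D l i j))
        (\<lambda>i j. E0 i j + (\<Sum>b\<in>Basis. (x \<bullet> b) * E b i j) + (\<Sum>l<p2. w (p1 + l) * F l i j))
        i j"
      by (cases "i < N1"; cases "j < N1")
        (simp_all add: sum_lessThan_plus A0_def A_def B_def block_diag_def)
  qed
  have "S \<inter> T = {x. \<exists>w. psd_mat (N1 + N2)
     (\<lambda>i j. A0 i j + (\<Sum>b\<in>Basis. (x \<bullet> b) * A b i j) + (\<Sum>l<p1 + p2. w l * B l i j))}"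
    unfolding eq psd_mat_block_diag
  proof (intro equalityI subsetI)
    fix x assume "x \<in> S \<inter> T"
    then obtain w1 w2 where
      "psd_mat N1 (\<lambda>i j. C0 i j + (\<Sum>b\<in>Basis. (x \<bullet> b) * C b i j) + (\<Sum>l<p1. w1 l * D l i j))"
      "psd_mat N2 (\<lambda>i j. E0 i j + (\<Sum>b\<in>Basis. (x \<bullet> b) * E b i j) + (\<Sum>l<p2. w2 l * F l i j))"
      by (auto simp: S T)
    then show "x \<in> {x. \<exists>w. psd_mat N1
          (\<lambda>i j. C0 i j + (\<Sum>b\<in>Basis. (x \<bullet> b) * C b i j) + (\<Sum>l<p1. w l * D l i j)) \<and>
        psd_mat N2
          (\<lambda>i j. E0 i j + (\<Sum>b\<in>Basis. (x \<bullet> b) * E b i j) + (\<Sum>l<p2. w (p1 + l) * F l i j))}"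
      by (intro CollectI exI[of _ "\<lambda>l. if l < p1 then w1 l else w2 (l - p1)"]) simp
  qed (auto simp: S T)
  moreover have "sym_mat (N1 + N2) A0" "\<forall>b\<in>Basis. sym_mat (N1 + N2) (A b)"
    "\<forall>l<p1 + p2. sym_mat (N1 + N2) (B l)"
    using sym1 sym2 by (auto simp: A0_def A_def B_def intro!: sym_mat_block_diag zero)
  ultimately show ?thesis
    unfolding sdr_def by blast
qed

text \<open>The form need not be symmetric: only its symmetric part enters the matrix inequality.\<close>

lemma sdr_nonneg_form:
  fixes Q :: "'a::euclidean_space \<Rightarrow> 'e::euclidean_space \<Rightarrow> 'e \<Rightarrow> real"
  assumes lin: "\<And>v w. linear (\<lambda>z. Q z v w)" and bil: "\<And>z. bilinear (Q z)"
  shows "sdr {z. \<forall>v. 0 \<le> Q z v v}"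
proof -
  define N where "N = DIM('e)"
  obtain e where e: "bij_betw e {..<N} (Basis :: 'e set)"
    unfolding N_def by (metis ex_bij_betw_nat_finite finite_Basis atLeast0LessThan)
  define A where "A = (\<lambda>b i j. (Q b (e i) (e j) + Q b (e j) (e i)) / 2)"
  have Q_Basis: "(\<Sum>b\<in>Basis. (z \<bullet> b) * Q b v w) = Q z v w" for z v w
  proof -
    have "Q z v w = Q (\<Sum>b\<in>Basis. (z \<bullet> b) *\<^sub>R b) v w"
      by (simp add: euclidean_representation)
    also have "\<dots> = (\<Sum>b\<in>Basis. (z \<bullet> b) * Q b v w)"
      using linear_sum[OF lin, of "\<lambda>b. (z \<bullet> b) *\<^sub>R b" Basis v w] linear_cmul[OF lin]
      by simp
    finally show ?thesis by simp
  qed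
  have mat: "(\<Sum>b\<in>Basis. (z \<bullet> b) * A b i j) = (Q z (e i) (e j) + Q z (e j) (e i)) / 2" for z i j
  proof -
    have "(\<Sum>b\<in>Basis. (z \<bullet> b) * A b i j) =
      ((\<Sum>b\<in>Basis. (z \<bullet> b) * Q b (e i) (e j)) + (\<Sum>b\<in>Basis. (z \<bullet> b) * Q b (e j) (e i))) / 2"
      by (simp add: A_def sum.distrib[symmetric] sum_divide_distrib algebra_simps)
    then show ?thesis by (simp only: Q_Basis)
  qed
  have form: "(\<Sum>i<N. \<Sum>j<N. v i * ((Q z (e i) (e j) + Q z (e j) (e i)) / 2) * v j)
      = Q z (\<Sum>i<N. v i *\<^sub>R e i) (\<Sum>i<N. v i *\<^sub>R e i)" for z v
  proof -
    have 1: "Q z (\<Sum>i<N. v i *\<^sub>R e i) (\<Sum>i<N. v i *\<^sub>R e i)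
        = (\<Sum>i<N. \<Sum>j<N. v i * Q z (e i) (e j) * v j)"
      by (simp add: bilinear_sum[OF bil] sum.cartesian_product bilinear_lmul[OF bil]
          bilinear_rmul[OF bil] algebra_simps)
    have "(\<Sum>i<N. \<Sum>j<N. v i * Q z (e j) (e i) * v j)
        = (\<Sum>i<N. \<Sum>j<N. v i * Q z (e i) (e j) * v j)"
      by (subst sum.swap) (simp add: mult_ac)
    moreover have "(\<Sum>i<N. \<Sum>j<N. v i * ((Q z (e i) (e j) + Q z (e j) (e i)) / 2) * v j)
      = ((\<Sum>i<N. \<Sum>j<N. v i * Q z (e i) (e j) * v j)
        + (\<Sum>i<N. \<Sum>j<N. v i * Q z (e j) (e i) * v j)) / 2"
      by (simp add: sum.distrib[symmetric] sum_divide_distrib algebra_simps add_divide_distrib)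
    ultimately show ?thesis
      using 1 by simp
  qed
  have "(\<forall>v. 0 \<le> Q z v v) \<longleftrightarrow> psd_mat N (\<lambda>i j. (Q z (e i) (e j) + Q z (e j) (e i)) / 2)" for z
  proof
    assume "psd_mat N (\<lambda>i j. (Q z (e i) (e j) + Q z (e j) (e i)) / 2)"
    then have 1: "0 \<le> Q z (\<Sum>i<N. c i *\<^sub>R e i) (\<Sum>i<N. c i *\<^sub>R e i)" for c
      unfolding psd_mat_def form by blast
    show "\<forall>v. 0 \<le> Q z v v"
    proof
      fix v :: 'e
      have "(\<Sum>i<N. (v \<bullet> e i) *\<^sub>R e i) = (\<Sum>b\<in>Basis. (v \<bullet> b) *\<^sub>R b)"
        by (rule sum.reindex_bij_betw[OF e])
      then show "0 \<le> Q z v v"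
        using 1[of "\<lambda>i. v \<bullet> e i"] by (simp add: euclidean_representation)
    qed
  next
    assume "\<forall>v. 0 \<le> Q z v v"
    then show "psd_mat N (\<lambda>i j. (Q z (e i) (e j) + Q z (e j) (e i)) / 2)"
      unfolding psd_mat_def form by (simp add: sym_mat_def add.commute)
  qed
  then have "{z. \<forall>v. 0 \<le> Q z v v} = {z. \<exists>w. psd_mat N
      (\<lambda>i j. 0 + (\<Sum>b\<in>Basis. (z \<bullet> b) * A b i j) + (\<Sum>l<0. w l * 0))}"
    by (simp add: mat)
  moreover have "\<forall>b\<in>Basis. sym_mat N (A b)"
    by (simp add: A_def sym_mat_def add.commute)
  moreover have "sym_mat N (\<lambda>_ _. 0)" "\<forall>l<0::nat. sym_mat N (\<lambda>_ _. 0)"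
    by (auto simp: sym_mat_def)
  ultimately show ?thesis
    unfolding sdr_def by (intro exI[of _ N] exI[of _ 0] exI[of _ "\<lambda>_ _. 0"] exI[of _ A] exI[of _ "\<lambda>_ _ _. 0"]) simp
qed

text \<open>A scalar inequality is a matrix inequality of size one: the form
  \<open>l z * v * v\<close> on the reals is nonnegative exactly when its value at
  \<open>v = 1\<close> is.\<close>

lemma sdr_nonneg_functional:
  fixes l :: "'a::euclidean_space \<Rightarrow> real"
  assumes "linear l"
  shows "sdr {z. 0 \<le> l z}"
proof -
  have "bilinear (\<lambda>v w. l z * v * (w :: real))" for z
    by (auto simp: bilinear_def algebra_simps intro!: linearI)
  moreover have "linear (\<lambda>z. l z * v * w)" for v w :: real
    using assms by (auto simp: linear_iff algebra_simps)
  ultimately have "sdr {z. \<forall>v::real. 0 \<le> l z * v * v}"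
    by (intro sdr_nonneg_form)
  moreover have "(\<forall>v::real. 0 \<le> l z * v * v) \<longleftrightarrow> 0 \<le> l z" for z
  proof
    assume "\<forall>v::real. 0 \<le> l z * v * v"
    then show "0 \<le> l z" by (metis mult.right_neutral)
  qed (simp add: mult.assoc)
  ultimately show ?thesis by simp
qed

lemma sdr_kernel:
  fixes l :: "'a::euclidean_space \<Rightarrow> real"
  assumes "linear l"
  shows "sdr {z. l z = 0}"
proof -
  have "{z. l z = 0} = {z. 0 \<le> l z} \<inter> {z. 0 \<le> - l z}"
    by auto
  then show ?thesis
    using assms sdr_Int sdr_nonneg_functional linear_compose_neg by metis
qed

lemma sdr_INT:
  fixes S :: "nat \<Rightarrow> 'a::euclidean_space set"
  assumes "finite I" "\<And>i. i \<in> I \<Longrightarrow> sdr (S i)"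
  shows "sdr (\<Inter>i\<in>I. S i)"
  using assms
proof (induction I rule: finite_induct)
  case empty
  have "sdr {z :: 'a. 0 \<le> (0 :: real)}"
    by (rule sdr_nonneg_functional) (simp add: linear_iff)
  then show ?case by simp
qed (auto intro: sdr_Int)

text \<open>The definition already ends in a block of existential variables; projecting appends the
  coordinates of \<open>y\<close> to that block.\<close>

lemma sdr_projection:
  fixes S :: "('a::euclidean_space \<times> 'b::euclidean_space) set"
  assumes "sdr S"
  shows "sdr {x. \<exists>y. (x, y) \<in> S}"
proof -
  obtain N p A0 and A :: "'a \<times> 'b \<Rightarrow> nat \<Rightarrow> nat \<Rightarrow> real" and B :: "nat \<Rightarrow> nat \<Rightarrow> nat \<Rightarrow> real"
    where sym: "sym_mat N A0" "\<forall>b\<in>Basis. sym_mat N (A b)" "\<forall>l<p. sym_mat N (B l)"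
      and S: "S = {z. \<exists>w. psd_mat N
               (\<lambda>i j. A0 i j + (\<Sum>b\<in>Basis. (z \<bullet> b) * A b i j) + (\<Sum>l<p. w l * B l i j))}"
    using assms unfolding sdr_def by blast
  define d where "d = DIM('b)"
  obtain e where e: "bij_betw e {..<d} (Basis :: 'b set)"
    unfolding d_def by (metis ex_bij_betw_nat_finite finite_Basis atLeast0LessThan)
  define A' where "A' = (\<lambda>b. A (b, 0))"
  define B' where "B' = (\<lambda>l. if l < p then B l else A (0, e (l - p)))"
  have Basis: "(\<Sum>b\<in>Basis. ((x, y) \<bullet> b) * A b i j)
      = (\<Sum>b\<in>Basis. (x \<bullet> b) * A' b i j) + (\<Sum>l<d. (y \<bullet> e l) * A (0, e l) i j)" for x y i j
  proof -
    have "(\<Sum>l<d. (y \<bullet> e l) * A (0, e l) i j) = (\<Sum>b\<in>Basis. (y \<bullet> b) * A (0, b) i j)"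
      by (rule sum.reindex_bij_betw[OF e])
    moreover have "(\<Sum>b\<in>Basis. h b) = (\<Sum>b\<in>Basis. h (b, 0)) + (\<Sum>b\<in>Basis. h (0, b))"
      for h :: "'a \<times> 'b \<Rightarrow> real"
      unfolding Basis_prod_def
      by (subst sum.union_disjoint) (auto simp: sum.reindex inj_on_def nonzero_Basis)
    ultimately show ?thesis
      by (simp add: A'_def)
  qed
  have split: "(\<Sum>l<p + d. w l * B' l i j)
      = (\<Sum>l<p. w l * B l i j) + (\<Sum>l<d. w (p + l) * A (0, e l) i j)" for w i j
    by (simp add: sum_lessThan_plus B'_def)
  have "{x. \<exists>y. (x, y) \<in> S} = {x. \<exists>w. psd_mat N
      (\<lambda>i j. A0 i j + (\<Sum>b\<in>Basis. (x \<bullet> b) * A' b i j) + (\<Sum>l<p + d. w l * B' l i j))}"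
  proof (intro equalityI subsetI)
    fix x assume "x \<in> {x. \<exists>y. (x, y) \<in> S}"
    then obtain y w where "psd_mat N (\<lambda>i j. A0 i j + (\<Sum>b\<in>Basis. ((x, y) \<bullet> b) * A b i j)
        + (\<Sum>l<p. w l * B l i j))"
      by (auto simp: S)
    then show "x \<in> {x. \<exists>w. psd_mat N
      (\<lambda>i j. A0 i j + (\<Sum>b\<in>Basis. (x \<bullet> b) * A' b i j) + (\<Sum>l<p + d. w l * B' l i j))}"
      by (intro CollectI exI[of _ "\<lambda>l. if l < p then w l else y \<bullet> e (l - p)"])
        (simp add: split Basis, simp add: add_ac)
  next
    fix x assume "x \<in> {x. \<exists>w. psd_mat N
      (\<lambda>i j. A0 i j + (\<Sum>b\<in>Basis. (x \<bullet> b) * A' b i j) + (\<Sum>l<p + d. w l * B' l i j))}"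
    then obtain w where w: "psd_mat N
      (\<lambda>i j. A0 i j + (\<Sum>b\<in>Basis. (x \<bullet> b) * A' b i j) + (\<Sum>l<p + d. w l * B' l i j))"
      by auto
    define y where "y = (\<Sum>l<d. w (p + l) *\<^sub>R e l)"
    have "y \<bullet> e l = w (p + l)" if "l < d" for l
    proof -
      have "e k \<bullet> e l = (if k = l then 1 else 0)" if "k < d" for k
        using that \<open>l < d\<close> e
        by (metis bij_betw_apply bij_betw_imp_inj_on inj_on_eq_iff inner_Basis lessThan_iff)
      then have "y \<bullet> e l = (\<Sum>k<d. if k = l then w (p + k) else 0)"
        unfolding y_def inner_sum_left by (intro sum.cong) auto
      then show ?thesis
        using that by simp
    qed
    then have "psd_mat N (\<lambda>i j. A0 i j + (\<Sum>b\<in>Basis. ((x, y) \<bullet> b) * A b i j)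
        + (\<Sum>l<p. w l * B l i j))"
      using w by (simp add: split Basis, simp add: add_ac)
    then show "x \<in> {x. \<exists>y. (x, y) \<in> S}"
      by (auto simp: S)
  qed
  moreover have "\<forall>b\<in>Basis. sym_mat N (A' b)"
    using sym by (auto simp: A'_def Basis_prod_def)
  moreover have "\<forall>l<p + d. sym_mat N (B' l)"
    using sym bij_betwE[OF e] by (auto simp: B'_def Basis_prod_def)
  ultimately show ?thesis
    using sym(1) unfolding sdr_def by blast
qed

text \<open>The bridge from the hypothesis on \<open>f\<close>, which speaks of sequences, to sets
  in Euclidean spaces: a linear map is substituted into the matrix inequality.\<close>

lemma sdr_linear_vimage_sdr_vec:
  fixes \<phi> :: "'a::euclidean_space \<Rightarrow> nat \<Rightarrow> real"
  assumes "sdr_vec d D" and lin: "\<And>k. linear (\<lambda>x. \<phi> x k)" and Rvec: "\<And>x. \<phi> x \<in> Rvec d"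
  shows "sdr {x. \<phi> x \<in> D}"
proof -
  obtain N p A0 and A :: "nat \<Rightarrow> nat \<Rightarrow> nat \<Rightarrow> real" and B :: "nat \<Rightarrow> nat \<Rightarrow> nat \<Rightarrow> real"
    where sym: "sym_mat N A0" "\<forall>k<d. sym_mat N (A k)" "\<forall>l<p. sym_mat N (B l)"
      and D: "D = {x \<in> Rvec d. \<exists>w. psd_mat N
               (\<lambda>i j. A0 i j + (\<Sum>k<d. x k * A k i j) + (\<Sum>l<p. w l * B l i j))}"
    using assms(1) unfolding sdr_vec_def by blast
  define A' where "A' = (\<lambda>b i j. \<Sum>k<d. \<phi> b k * A k i j)"
  have "(\<Sum>b\<in>Basis. (x \<bullet> b) * A' b i j) = (\<Sum>k<d. \<phi> x k * A k i j)" for x i j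
  proof -
    have "\<phi> x k = (\<Sum>b\<in>Basis. (x \<bullet> b) * \<phi> b k)" for k
    proof -
      have "\<phi> x k = \<phi> (\<Sum>b\<in>Basis. (x \<bullet> b) *\<^sub>R b) k"
        by (simp add: euclidean_representation)
      also have "\<dots> = (\<Sum>b\<in>Basis. (x \<bullet> b) * \<phi> b k)"
        using linear_sum[OF lin, of "\<lambda>b. (x \<bullet> b) *\<^sub>R b" Basis k] linear_cmul[OF lin] by simp
      finally show ?thesis .
    qed
    then have "(\<Sum>k<d. \<phi> x k * A k i j) = (\<Sum>k<d. \<Sum>b\<in>Basis. (x \<bullet> b) * \<phi> b k * A k i j)"
      by (simp add: sum_distrib_right)
    also have "\<dots> = (\<Sum>b\<in>Basis. (x \<bullet> b) * A' b i j)"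
      by (subst sum.swap) (simp add: A'_def sum_distrib_left mult.assoc)
    finally show ?thesis ..
  qed
  then have "{x. \<phi> x \<in> D} = {x. \<exists>w. psd_mat N
      (\<lambda>i j. A0 i j + (\<Sum>b\<in>Basis. (x \<bullet> b) * A' b i j) + (\<Sum>l<p. w l * B l i j))}"
    using Rvec by (simp add: D)
  moreover have "\<forall>b\<in>Basis. sym_mat N (A' b)"
    using sym by (auto simp: sym_mat_def A'_def intro!: sum.cong)
  ultimately show ?thesis
    using sym unfolding sdr_def by blast
qed

subsection \<open>Orthonormal families\<close>

text \<open>Indexed families, because singular vectors are paired by index with singular values. The
  values from \<open>k\<close> on are left free.\<close>

definition orthonormal_upto :: "nat \<Rightarrow> (nat \<Rightarrow> 'a::real_inner) \<Rightarrow> bool" where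
  "orthonormal_upto k x \<longleftrightarrow> (\<forall>i<k. \<forall>j<k. x i \<bullet> x j = (if i = j then 1 else 0))"

lemma orthonormal_upto_mono:
  "orthonormal_upto k x \<Longrightarrow> j \<le> k \<Longrightarrow> orthonormal_upto j x"
  by (simp add: orthonormal_upto_def)

lemma orthonormal_upto_Suc:
  assumes "orthonormal_upto k x" "norm a = 1" "\<And>i. i < k \<Longrightarrow> a \<bullet> x i = 0"
  shows "orthonormal_upto (Suc k) (x(k := a))"
  using assms by (auto simp: orthonormal_upto_def less_Suc_eq norm_eq_1 inner_commute)

lemma orthonormal_upto_sum_inner:
  assumes "orthonormal_upto k x" "i < k"
  shows "(\<Sum>j<k. c j *\<^sub>R x j) \<bullet> x i = c i"
proof -
  have "(\<Sum>j<k. c j *\<^sub>R x j) \<bullet> x i = (\<Sum>j<k. if j = i then c j else 0)"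
    unfolding inner_sum_left using assms by (intro sum.cong) (auto simp: orthonormal_upto_def)
  then show ?thesis
    using assms(2) by simp
qed

lemma orthonormal_upto_independent:
  assumes "orthonormal_upto k x"
  shows "independent (x ` {..<k})" "card (x ` {..<k}) = k"
proof -
  have "inj_on x {..<k}"
    using assms by (intro inj_onI) (metis lessThan_iff orthonormal_upto_def zero_neq_one)
  then show "card (x ` {..<k}) = k"
    by (simp add: card_image)
  show "independent (x ` {..<k})"
  proof (rule pairwise_orthogonal_independent)
    show "pairwise orthogonal (x ` {..<k})"
      using assms by (auto simp: pairwise_def orthogonal_def orthonormal_upto_def)
    show "0 \<notin> x ` {..<k}"
      using assms by (force simp: orthonormal_upto_def)
  qed
qed

text \<open>With \<open>P\<close> the orthogonal projection onto the span of the \<open>x i\<close>,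
  the traces of \<open>PZ\<close>, \<open>ZP\<close> and \<open>PZP\<close> all equal the left-hand
  sum. Expanding the trace of \<open>(I - P)Z(I - P)\<close>, which is nonnegative, leaves the trace
  of \<open>Z\<close> minus that sum.\<close>

lemma sum_form_orthonormal_le_trace:
  fixes Z :: "'a::euclidean_space \<Rightarrow> 'a \<Rightarrow> real"
  assumes bil: "bilinear Z" and pos: "\<And>a. 0 \<le> Z a a" and on: "orthonormal_upto k x"
  shows "(\<Sum>i<k. Z (x i) (x i)) \<le> (\<Sum>e\<in>Basis. Z e e)"
proof -
  define P where "P a = (\<Sum>i<k. (a \<bullet> x i) *\<^sub>R x i)" for a
  have lin_P: "linear P"
    by (rule linearI) (simp_all add: P_def inner_add_left scaleR_add_left sum.distrib scaleR_sum_right)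
  have lin_l: "linear (\<lambda>a. Z a b)" and lin_r: "linear (\<lambda>a. Z b a)" for b
    using bil by (auto simp: bilinear_def)
  have Z_P_l: "Z (P a) b = (\<Sum>i<k. (a \<bullet> x i) * Z (x i) b)" for a b
    by (simp add: P_def linear_sum[OF lin_l] linear_cmul[OF lin_l])
  have Z_P_r: "Z b (P a) = (\<Sum>i<k. (a \<bullet> x i) * Z b (x i))" for a b
    by (simp add: P_def linear_sum[OF lin_r] linear_cmul[OF lin_r])
  have basis: "(\<Sum>e\<in>Basis. (e \<bullet> v) * h e) = h v" if "linear h" for h :: "'a \<Rightarrow> real" and v
  proof -
    have "h v = h (\<Sum>e\<in>Basis. (v \<bullet> e) *\<^sub>R e)"
      by (simp add: euclidean_representation)
    then show ?thesis
      by (simp add: linear_sum[OF that] linear_cmul[OF that] inner_commute)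
  qed
  have P_x: "P (x i) = x i" if "i < k" for i
  proof -
    have "P (x i) = (\<Sum>j<k. (if j = i then 1 else 0) *\<^sub>R x j)"
      unfolding P_def using that on by (intro sum.cong) (auto simp: orthonormal_upto_def)
    also have "\<dots> = (\<Sum>j<k. if j = i then x j else 0)"
      by (intro sum.cong) auto
    finally show ?thesis
      using that by simp
  qed
  have 1: "(\<Sum>e\<in>Basis. Z (P e) e) = (\<Sum>i<k. Z (x i) (x i))"
    unfolding Z_P_l by (subst sum.swap) (simp add: basis[OF lin_r])
  have 2: "(\<Sum>e\<in>Basis. Z e (P e)) = (\<Sum>i<k. Z (x i) (x i))"
    unfolding Z_P_r by (subst sum.swap) (simp add: basis[OF lin_l])
  have "linear (\<lambda>a. Z b (P a))" for b
    using linear_compose[OF lin_P lin_r] by (simp add: o_def)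
  then have 3: "(\<Sum>e\<in>Basis. Z (P e) (P e)) = (\<Sum>i<k. Z (x i) (x i))"
    unfolding Z_P_l by (subst sum.swap) (simp add: basis P_x)
  have "0 \<le> (\<Sum>e\<in>Basis. Z (e - P e) (e - P e))"
    by (intro sum_nonneg pos)
  also have "\<dots> = (\<Sum>e\<in>Basis. Z e e) - (\<Sum>e\<in>Basis. Z e (P e)) - (\<Sum>e\<in>Basis. Z (P e) e)
      + (\<Sum>e\<in>Basis. Z (P e) (P e))"
    by (simp add: bilinear_lsub[OF bil] bilinear_rsub[OF bil] sum_subtractf sum.distrib algebra_simps)
  finally show ?thesis
    using 1 2 3 by simp
qed

text \<open>The rank-one form built from \<open>v\<close> has trace \<open>v \<bullet> v\<close>, so
  the preceding trace bound applies.\<close>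

lemma bessel_inequality:
  fixes x :: "nat \<Rightarrow> 'a::euclidean_space"
  assumes "orthonormal_upto k x"
  shows "(\<Sum>i<k. (v \<bullet> x i)\<^sup>2) \<le> v \<bullet> v"
proof -
  have "bilinear (\<lambda>a b. (v \<bullet> a) * (v \<bullet> b))"
    by (auto simp: bilinear_def algebra_simps inner_add_right intro!: linearI)
  then have "(\<Sum>i<k. (v \<bullet> x i) * (v \<bullet> x i)) \<le> (\<Sum>e\<in>Basis. (v \<bullet> e) * (v \<bullet> e))"
    by (rule sum_form_orthonormal_le_trace) (auto simp: assms)
  then show ?thesis
    by (simp add: euclidean_inner[of v v] power2_eq_square)
qed

section \<open>Matrix forms, traces and sums of rank-one matrices\<close>

lemma bilinear_matrix_form: "bilinear (\<lambda>a b. a \<bullet> ((M :: real^'n^'m) *v b))"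
  by (auto simp: bilinear_def algebra_simps inner_add_left inner_add_right
      matrix_vector_right_distrib matrix_vector_mult_scaleR intro!: linearI)

lemma trace_eq_sum_Basis:
  fixes Z :: "real^'n^'n"
  shows "(\<Sum>e\<in>Basis. e \<bullet> (Z *v e)) = trace Z"
proof -
  have "(\<Sum>e\<in>Basis. e \<bullet> (Z *v e)) = (\<Sum>i\<in>UNIV. axis i 1 \<bullet> (Z *v axis i 1))"
    by (simp add: Basis_vec_def UNION_singleton_eq_range sum.reindex inj_on_def axis_eq_axis)
  also have "\<dots> = trace Z"
    by (simp add: trace_def inner_axis' matrix_vector_mult_basis column_def)
  finally show ?thesis .
qed

lemma outer_mult_vec: "outer u v *v w = (v \<bullet> w) *\<^sub>R u"
  by (simp add: outer_def matrix_vector_mult_def vec_eq_iff inner_vec_def sum_distrib_right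
      sum_distrib_left mult_ac)

lemma inner_outer: "outer u v \<bullet> M = u \<bullet> (M *v v)"
  by (simp add: outer_def matrix_vector_mult_def inner_vec_def sum_distrib_left mult_ac)

lemma sum_outer_mult_vec:
  "(\<Sum>i<(k::nat). c i *\<^sub>R outer (x i) (y i)) *v b = (\<Sum>i<k. (c i * (b \<bullet> y i)) *\<^sub>R x i)"
  by (induction k)
    (simp_all add: matrix_vector_mult_add_rdistrib scaleR_matrix_vector_assoc[symmetric]
      outer_mult_vec inner_commute)

lemma form_sum_outer:
  "a \<bullet> ((\<Sum>i<(k::nat). c i *\<^sub>R outer (x i) (y i)) *v b) = (\<Sum>i<k. c i * ((a \<bullet> x i) * (b \<bullet> y i)))"
  by (simp add: sum_outer_mult_vec inner_sum_right mult_ac)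

lemma trace_sum_outer:
  "trace (\<Sum>i<(k::nat). c i *\<^sub>R outer (x i) (y i)) = (\<Sum>i<k. c i * (x i \<bullet> y i))"
proof (induction k)
  case (Suc k)
  have "trace (c k *\<^sub>R outer (x k) (y k)) = c k * (x k \<bullet> y k)"
    by (simp add: trace_def outer_def inner_vec_def sum_distrib_left)
  then show ?case
    using Suc by (simp add: trace_add)
qed (simp add: trace_def)

subsection \<open>Ky Fan norms\<close>

text \<open>A semidefinite certificate for the Ky Fan norm (the sum of the \<open>k\<close> largest singular values)
  of \<open>M\<close> being at most \<open>t\<close>.\<close>

definition ky_fan_bound :: "nat \<Rightarrow> real^'n^'m \<Rightarrow> real \<Rightarrow> bool" where
  "ky_fan_bound k M t \<longleftrightarrow> (\<exists>(Z :: real^'m^'m) (W :: real^'n^'n) s.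
     (\<forall>a. 0 \<le> a \<bullet> (Z *v a)) \<and> (\<forall>b. 0 \<le> b \<bullet> (W *v b)) \<and>
     (\<forall>a b. 2 * (a \<bullet> (M *v b)) \<le> a \<bullet> (Z *v a) + b \<bullet> (W *v b) + s * (a \<bullet> a + b \<bullet> b)) \<and>
     trace Z + trace W + 2 * real k * s \<le> 2 * t)"

text \<open>Soundness of the certificate: its inequality is tested on the pairs
  \<open>(x i, y i)\<close> and summed. The terms in \<open>Z\<close> and \<open>W\<close>
  contribute at most their traces, and the unit lengths contribute \<open>2 * s\<close> for each
  pair.\<close>

lemma ky_fan_bound_imp_sum_le:
  assumes "ky_fan_bound k M t" and x: "orthonormal_upto k x" and y: "orthonormal_upto k y"
  shows "(\<Sum>i<k. x i \<bullet> (M *v y i)) \<le> t"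
proof -
  obtain Z W s where Z: "\<And>a. 0 \<le> a \<bullet> (Z *v a)" and W: "\<And>b. 0 \<le> b \<bullet> (W *v b)"
    and M: "\<And>a b. 2 * (a \<bullet> (M *v b)) \<le> a \<bullet> (Z *v a) + b \<bullet> (W *v b) + s * (a \<bullet> a + b \<bullet> b)"
    and t: "trace Z + trace W + 2 * real k * s \<le> 2 * t"
    using assms(1) unfolding ky_fan_bound_def by blast
  have "2 * (\<Sum>i<k. x i \<bullet> (M *v y i)) = (\<Sum>i<k. 2 * (x i \<bullet> (M *v y i)))"
    by (simp add: sum_distrib_left)
  also have "\<dots> \<le> (\<Sum>i<k. x i \<bullet> (Z *v x i) + y i \<bullet> (W *v y i) + 2 * s)"
  proof (intro sum_mono)
    fix i assume "i \<in> {..<k}"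
    then have "x i \<bullet> x i = 1" "y i \<bullet> y i = 1"
      using x y by (simp_all add: orthonormal_upto_def)
    then show "2 * (x i \<bullet> (M *v y i)) \<le> x i \<bullet> (Z *v x i) + y i \<bullet> (W *v y i) + 2 * s"
      using M[of "x i" "y i"] by simp
  qed
  also have "\<dots> = (\<Sum>i<k. x i \<bullet> (Z *v x i)) + (\<Sum>i<k. y i \<bullet> (W *v y i)) + 2 * real k * s"
    by (simp add: sum.distrib)
  also have "\<dots> \<le> trace Z + trace W + 2 * real k * s"
    using sum_form_orthonormal_le_trace[OF bilinear_matrix_form Z x]
      sum_form_orthonormal_le_trace[OF bilinear_matrix_form W y]
    by (simp add: trace_eq_sum_Basis)
  finally show ?thesis
    using t by simp
qed

lemma Delta_plusD:
  assumes "s \<in> Delta_plus q"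
  shows "i \<le> j \<Longrightarrow> j < q \<Longrightarrow> s j \<le> s i" "i < q \<Longrightarrow> 0 \<le> s i" "q \<le> i \<Longrightarrow> s i = 0"
  using assms by (auto simp: Delta_plus_def Rvec_def)

text \<open>Completeness of the certificate: a singular value decomposition yields one whose bound
  is exactly the sum of the \<open>Suc k\<close> largest values. The scalar is the threshold
  \<open>s k\<close>, and \<open>Z\<close> and \<open>W\<close> carry the excess of the larger
  values over it.\<close>

lemma ky_fan_bound_sum_outer:
  assumes s: "s \<in> Delta_plus q" and x: "orthonormal_upto q x" and y: "orthonormal_upto q y"
    and k: "k < q"
  shows "ky_fan_bound (Suc k) (\<Sum>i<q. s i *\<^sub>R outer (x i) (y i)) (\<Sum>i<Suc k. s i)"
proof -
  \<comment> \<open>\<open>s k\<close> is the last and smallest of the \<open>Suc k\<close> values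
    counted, so the excess is nonnegative up to \<open>k\<close> and zero at \<open>k\<close>
    itself.\<close>
  define c where "c i = s i - s k" for i
  define Z where "Z = (\<Sum>i<Suc k. c i *\<^sub>R outer (x i) (x i))"
  define W where "W = (\<Sum>i<Suc k. c i *\<^sub>R outer (y i) (y i))"
  have c: "0 \<le> c i" if "i < Suc k" for i
    using Delta_plusD(1)[OF s, of i k] that k by (simp add: c_def)
  have sk: "0 \<le> s k"
    using Delta_plusD(2)[OF s k] .
  have Z: "a \<bullet> (Z *v a) = (\<Sum>i<Suc k. c i * (a \<bullet> x i)\<^sup>2)" for a
    unfolding Z_def form_sum_outer by (simp add: power2_eq_square)
  have W: "b \<bullet> (W *v b) = (\<Sum>i<Suc k. c i * (b \<bullet> y i)\<^sup>2)" for b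
    unfolding W_def form_sum_outer by (simp add: power2_eq_square)
  have pos: "0 \<le> (\<Sum>i<Suc k. c i * (h i)\<^sup>2)" for h
    by (intro sum_nonneg mult_nonneg_nonneg) (auto intro: c)
  have le: "(\<Sum>i<q. s i * (v \<bullet> z i)\<^sup>2) \<le> (\<Sum>i<Suc k. c i * (v \<bullet> z i)\<^sup>2) + s k * (v \<bullet> v)"
    if "orthonormal_upto q z" for z :: "nat \<Rightarrow> real^'k" and v
  proof -
    \<comment> \<open>Up to index \<open>k\<close>, \<open>s i\<close> is \<open>c i + s k\<close>;
      beyond it, \<open>s i\<close> is at most \<open>s k\<close>. Bessel's inequality then absorbs
      the common \<open>s k\<close> part.\<close>
    have "(\<Sum>i<q. s i * (v \<bullet> z i)\<^sup>2)
        \<le> (\<Sum>i<q. (if i < Suc k then c i * (v \<bullet> z i)\<^sup>2 else 0) + s k * (v \<bullet> z i)\<^sup>2)"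
    proof (intro sum_mono)
      fix i assume "i \<in> {..<q}"
      then show "s i * (v \<bullet> z i)\<^sup>2
          \<le> (if i < Suc k then c i * (v \<bullet> z i)\<^sup>2 else 0) + s k * (v \<bullet> z i)\<^sup>2"
        using Delta_plusD(1)[OF s, of k i] by (auto simp: c_def algebra_simps intro!: mult_right_mono)
    qed
    also have "\<dots> = (\<Sum>i<q. if i < Suc k then c i * (v \<bullet> z i)\<^sup>2 else 0)
        + s k * (\<Sum>i<q. (v \<bullet> z i)\<^sup>2)"
      by (simp add: sum.distrib sum_distrib_left)
    also have "(\<Sum>i<q. if i < Suc k then c i * (v \<bullet> z i)\<^sup>2 else 0)
        = (\<Sum>i<Suc k. c i * (v \<bullet> z i)\<^sup>2)"
      using k by (intro sum.mono_neutral_cong_right) auto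
    finally show ?thesis
      using mult_left_mono[OF bessel_inequality[OF that] sk] by (meson add_left_mono order_trans)
  qed
  have "2 * (a \<bullet> ((\<Sum>i<q. s i *\<^sub>R outer (x i) (y i)) *v b))
      \<le> a \<bullet> (Z *v a) + b \<bullet> (W *v b) + s k * (a \<bullet> a + b \<bullet> b)" for a b
  proof -
    have "2 * (a \<bullet> ((\<Sum>i<q. s i *\<^sub>R outer (x i) (y i)) *v b))
        = (\<Sum>i<q. s i * (2 * (a \<bullet> x i) * (b \<bullet> y i)))"
      by (simp add: form_sum_outer sum_distrib_left mult_ac)
    \<comment> \<open>The arithmetic-geometric mean inequality decouples \<open>a\<close> from
      \<open>b\<close>, so that each side can be bounded by its own form.\<close>
    also have "\<dots> \<le> (\<Sum>i<q. s i * ((a \<bullet> x i)\<^sup>2 + (b \<bullet> y i)\<^sup>2))"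
      by (intro sum_mono mult_left_mono sum_squares_bound) (auto intro: Delta_plusD(2)[OF s])
    also have "\<dots> = (\<Sum>i<q. s i * (a \<bullet> x i)\<^sup>2) + (\<Sum>i<q. s i * (b \<bullet> y i)\<^sup>2)"
      by (simp add: sum.distrib algebra_simps)
    finally show ?thesis
      using le[OF x, of a] le[OF y, of b] by (simp add: Z W algebra_simps)
  qed
  moreover have "trace Z = (\<Sum>i<Suc k. c i)" "trace W = (\<Sum>i<Suc k. c i)"
    unfolding Z_def W_def trace_sum_outer using x y k
    by (auto simp: orthonormal_upto_def intro!: sum.cong)
  then have "trace Z + trace W + 2 * real (Suc k) * s k = 2 * (\<Sum>i<Suc k. s i)"
    unfolding c_def sum_subtractf by (simp add: algebra_simps)
  ultimately show ?thesis
    unfolding ky_fan_bound_def using Z W pos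
    by (intro exI[of _ Z] exI[of _ W] exI[of _ "s k"]) auto
qed

subsection \<open>Singular value decomposition\<close>

lemma exists_unit_orthogonal:
  fixes x :: "nat \<Rightarrow> 'a::euclidean_space"
  assumes "k < DIM('a)"
  obtains a where "norm a = 1" "\<And>i. i < k \<Longrightarrow> a \<bullet> x i = 0"
proof -
  have "dim (x ` {..<k}) \<le> card (x ` {..<k})"
    by (intro dim_le_card') auto
  also have "\<dots> \<le> k"
    using card_image_le[of "{..<k}" x] by simp
  finally obtain b where b: "b \<noteq> 0" "\<And>v. v \<in> span (x ` {..<k}) \<Longrightarrow> orthogonal b v"
    using orthogonal_to_subspace_exists[of "x ` {..<k}"] assms by auto
  show ?thesis
  proof
    show "norm (b /\<^sub>R norm b) = 1"
      using b(1) by simp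
    show "(b /\<^sub>R norm b) \<bullet> x i = 0" if "i < k" for i
      using b(2)[OF span_base, of "x i"] that by (simp add: orthogonal_def)
  qed
qed

text \<open>The singular triples are chosen greedily: the next one maximises \<open>a \<bullet> f b\<close> over the unit
  vectors orthogonal to the vectors already chosen, which also makes the values decrease.\<close>

lemma singular_triples_exist:
  fixes f :: "'b::euclidean_space \<Rightarrow> 'a::euclidean_space"
  assumes lin: "linear f" and k: "k \<le> min DIM('a) DIM('b)"
  shows "\<exists>s x y. orthonormal_upto k x \<and> orthonormal_upto k y \<and>
    (\<forall>i<k. f (y i) = s i *\<^sub>R x i \<and> adjoint f (x i) = s i *\<^sub>R y i \<and> 0 \<le> s i) \<and>
    (\<forall>i j. i \<le> j \<longrightarrow> j < k \<longrightarrow> s j \<le> s i) \<and>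
    (\<forall>a b. norm a = 1 \<longrightarrow> norm b = 1 \<longrightarrow> (\<forall>i<k. a \<bullet> x i = 0) \<longrightarrow> (\<forall>i<k. b \<bullet> y i = 0) \<longrightarrow>
       (\<forall>i<k. a \<bullet> f b \<le> s i))"
  using k
proof (induction k)
  case 0
  then show ?case
    by (simp add: orthonormal_upto_def)
next
  case (Suc k)
  have "k \<le> min DIM('a) DIM('b)"
    using Suc.prems by simp
  from Suc.IH[OF this] obtain s x y where x: "orthonormal_upto k x" and y: "orthonormal_upto k y"
    and triple: "\<forall>i<k. f (y i) = s i *\<^sub>R x i \<and> adjoint f (x i) = s i *\<^sub>R y i \<and> 0 \<le> s i"
    and mono: "\<forall>i j. i \<le> j \<longrightarrow> j < k \<longrightarrow> s j \<le> s i"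
    and bound: "\<forall>a b. norm a = 1 \<longrightarrow> norm b = 1 \<longrightarrow> (\<forall>i<k. a \<bullet> x i = 0) \<longrightarrow>
       (\<forall>i<k. b \<bullet> y i = 0) \<longrightarrow> (\<forall>i<k. a \<bullet> f b \<le> s i)"
    by (elim exE conjE)
  have fy: "f (y i) = s i *\<^sub>R x i" and fx: "adjoint f (x i) = s i *\<^sub>R y i" and s0: "0 \<le> s i"
    if "i < k" for i
    using triple that by auto
  define A where "A = sphere 0 1 \<inter> (\<Inter>i<k. {a. a \<bullet> x i = 0})"
  define B where "B = sphere 0 1 \<inter> (\<Inter>i<k. {b. b \<bullet> y i = 0})"
  have A: "a \<in> A \<longleftrightarrow> norm a = 1 \<and> (\<forall>i<k. a \<bullet> x i = 0)" for a
    by (auto simp: A_def)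
  have B: "b \<in> B \<longleftrightarrow> norm b = 1 \<and> (\<forall>i<k. b \<bullet> y i = 0)" for b
    by (auto simp: B_def)
  have "compact (A \<times> B)"
    unfolding A_def B_def
    by (intro compact_Times compact_Int_closed compact_sphere closed_INT ballI closed_Collect_eq
        continuous_intros)
  moreover have "A \<times> B \<noteq> {}"
  proof -
    have "k < DIM('a)" "k < DIM('b)"
      using Suc.prems by auto
    then obtain a b where "norm a = 1" "\<And>i. i < k \<Longrightarrow> a \<bullet> x i = 0"
      "norm b = 1" "\<And>i. i < k \<Longrightarrow> b \<bullet> y i = 0"
      using exists_unit_orthogonal[of k x] exists_unit_orthogonal[of k y] by metis
    then have "(a, b) \<in> A \<times> B"
      by (simp add: A B)
    then show ?thesis by blast
  qed
  moreover have "continuous_on (A \<times> B) (\<lambda>p. fst p \<bullet> f (snd p))"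
    by (intro continuous_on_inner continuous_on_fst continuous_on_id
        linear_continuous_on_compose[OF continuous_on_snd[OF continuous_on_id] lin])
  ultimately obtain p where p: "p \<in> A \<times> B"
      "\<And>p'. p' \<in> A \<times> B \<Longrightarrow> fst p' \<bullet> f (snd p') \<le> fst p \<bullet> f (snd p)"
    using continuous_attains_sup[of "A \<times> B" "\<lambda>p. fst p \<bullet> f (snd p)"] by blast
  obtain a b where ab: "p = (a, b)"
    by (cases p)
  define t where "t = a \<bullet> f b"
  have a: "a \<in> A" and b: "b \<in> B" and max: "\<And>a' b'. a' \<in> A \<Longrightarrow> b' \<in> B \<Longrightarrow> a' \<bullet> f b' \<le> t"
    using p by (force simp: ab t_def)+
  have t0: "0 \<le> t"
  proof -
    \<comment> \<open>Negating \<open>a\<close> stays feasible and flips the sign of the value, so a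
      negative maximum is impossible.\<close>
    have "- a \<in> A"
      using a by (simp add: A)
    from max[OF this b] show ?thesis
      by (simp add: t_def)
  qed
  have adj: "u \<bullet> adjoint f v = f u \<bullet> v" for u v
    using adjoint_works[OF lin] .
  \<comment> \<open>The equality case of Cauchy-Schwarz: \<open>w\<close> has norm at most
    \<open>t\<close> but inner product \<open>t\<close> with the unit vector \<open>c\<close>. It is
    stated over a general space because it is applied both to \<open>f b\<close> and to
    \<open>adjoint f a\<close>.\<close>
  have eq: "w = t *\<^sub>R c"
    if "norm c = 1" "c \<bullet> w = t" "w \<noteq> 0 \<Longrightarrow> (w /\<^sub>R norm w) \<bullet> w \<le> t"
    for c w :: "'c::real_inner"
  proof -
    have "norm w \<le> t"
    proof (cases "w = 0")
      case False
      have "(w /\<^sub>R norm w) \<bullet> w = norm w"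
        using False by (simp add: power2_norm_eq_inner[symmetric] power2_eq_square)
      then show ?thesis
        using that(3) False by simp
    qed (simp add: t0)
    then have "w \<bullet> w \<le> t\<^sup>2"
      using power_mono[of "norm w" t 2] by (simp add: power2_norm_eq_inner)
    moreover have "(w - t *\<^sub>R c) \<bullet> (w - t *\<^sub>R c) = w \<bullet> w - 2 * t * (c \<bullet> w) + t\<^sup>2 * (c \<bullet> c)"
      by (simp add: inner_diff_left inner_diff_right inner_commute algebra_simps power2_eq_square)
    ultimately have "(w - t *\<^sub>R c) \<bullet> (w - t *\<^sub>R c) \<le> 0"
      using that(1,2) by (simp add: norm_eq_1 power2_eq_square)
    then show ?thesis
      by (metis inner_eq_zero_iff inner_ge_zero order_antisym right_minus_eq)
  qed
  have fb: "f b = t *\<^sub>R a"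
  proof (rule eq)
    assume "f b \<noteq> 0"
    \<comment> \<open>\<open>adjoint f (x i)\<close> is a multiple of \<open>y i\<close>, which is
      orthogonal to \<open>b\<close>. Hence the normalised \<open>f b\<close> is itself a competitor
      in the maximisation.\<close>
    have "f b \<bullet> x i = 0" if "i < k" for i
      using adj[of b "x i"] fx[OF that] b that by (simp add: B)
    then have "f b /\<^sub>R norm (f b) \<in> A"
      using \<open>f b \<noteq> 0\<close> by (simp add: A)
    then show "(f b /\<^sub>R norm (f b)) \<bullet> f b \<le> t"
      using max b by blast
  qed (use a in \<open>auto simp: A t_def\<close>)
  have fa: "adjoint f a = t *\<^sub>R b"
  proof (rule eq)
    assume nz: "adjoint f a \<noteq> 0"
    have "adjoint f a \<bullet> y i = 0" if "i < k" for i
      using adj[of "y i" a] fy[OF that] a that by (simp add: A inner_commute)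
    then have "adjoint f a /\<^sub>R norm (adjoint f a) \<in> B"
      using nz by (simp add: B)
    then show "(adjoint f a /\<^sub>R norm (adjoint f a)) \<bullet> adjoint f a \<le> t"
      using max[OF a] adj[of "adjoint f a /\<^sub>R norm (adjoint f a)" a] by (simp add: inner_commute)
    next
      show "b \<bullet> adjoint f a = t"
        by (simp add: adj t_def inner_commute)
  qed (use b in \<open>auto simp: B\<close>)
  \<comment> \<open>Here the last clause of the induction hypothesis pays off: \<open>a\<close> and
    \<open>b\<close> are orthogonal to all earlier vectors, so their value cannot exceed any earlier
    one.\<close>
  have t_le: "t \<le> s i" if "i < k" for i
    using bound a b that by (simp add: A B t_def)
  let ?s = "s(k := t)" and ?x = "x(k := a)" and ?y = "y(k := b)"
  have "orthonormal_upto (Suc k) ?x" "orthonormal_upto (Suc k) ?y"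
    using orthonormal_upto_Suc[OF x] orthonormal_upto_Suc[OF y] a b by (simp_all add: A B)
  moreover have "\<forall>i<Suc k. f (?y i) = ?s i *\<^sub>R ?x i \<and> adjoint f (?x i) = ?s i *\<^sub>R ?y i \<and> 0 \<le> ?s i"
    using fb fa t0 fx fy s0 by (auto simp: less_Suc_eq)
  moreover have "\<forall>i j. i \<le> j \<longrightarrow> j < Suc k \<longrightarrow> ?s j \<le> ?s i"
    using mono t_le by (auto simp: less_Suc_eq)
  moreover have "\<forall>i<Suc k. a' \<bullet> f b' \<le> ?s i"
    if "norm a' = 1" "norm b' = 1" "\<forall>i<Suc k. a' \<bullet> ?x i = 0" "\<forall>i<Suc k. b' \<bullet> ?y i = 0" for a' b'
  proof -
    have "a' \<in> A" "b' \<in> B"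
      using that by (fastforce simp: A B less_Suc_eq)+
    then have "a' \<bullet> f b' \<le> t"
      by (rule max)
    then show ?thesis
      using t_le by (fastforce simp: less_Suc_eq)
  qed
  ultimately show ?case
    by blast
qed

lemma orthonormal_expansion:
  fixes x :: "nat \<Rightarrow> 'a::euclidean_space"
  assumes "orthonormal_upto DIM('a) x"
  shows "(\<Sum>i<DIM('a). (a \<bullet> x i) *\<^sub>R x i) = a"
proof -
  let ?r = "a - (\<Sum>i<DIM('a). (a \<bullet> x i) *\<^sub>R x i)"
  have "orthogonal ?r v" if "v \<in> x ` {..<DIM('a)}" for v
    using that orthonormal_upto_sum_inner[OF assms]
    by (auto simp: orthogonal_def inner_diff_left)
  \<comment> \<open>An orthonormal family of full size spans the space, so the residual is
    orthogonal to itself.\<close>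
  then have "orthogonal ?r ?r"
    using orthogonal_to_span[of ?r "x ` {..<DIM('a)}" ?r]
      card_eq_dim[of "x ` {..<DIM('a)}" UNIV] orthonormal_upto_independent[OF assms]
    by (auto simp: orthogonal_commute)
  then show ?thesis
    by (simp add: orthogonal_self)
qed

text \<open>The property inside the definite description of \<open>svals\<close>, with the singular
  vectors kept as parameters.\<close>

definition is_svd :: "real^'n^'m \<Rightarrow> (nat \<Rightarrow> real) \<Rightarrow> (nat \<Rightarrow> real^'m) \<Rightarrow> (nat \<Rightarrow> real^'n) \<Rightarrow> bool" where
  "is_svd M s x y \<longleftrightarrow> s \<in> Delta_plus (min CARD('m) CARD('n)) \<and>
     orthonormal_upto (min CARD('m) CARD('n)) x \<and> orthonormal_upto (min CARD('m) CARD('n)) y \<and>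
     M = (\<Sum>k<min CARD('m) CARD('n). s k *\<^sub>R outer (x k) (y k))"

lemma svd_exists:
  fixes M :: "real^'n^'m"
  shows "\<exists>s x y. is_svd M s x y"
proof -
  define q where "q = min CARD('m) CARD('n)"
  have "q \<le> min DIM(real^'m) DIM(real^'n)"
    by (simp add: q_def)
  then obtain s x y where x: "orthonormal_upto q x" and y: "orthonormal_upto q y"
    and My: "\<And>i. i < q \<Longrightarrow> M *v y i = s i *\<^sub>R x i"
    and Mx: "\<And>i. i < q \<Longrightarrow> adjoint ((*v) M) (x i) = s i *\<^sub>R y i"
    and s0: "\<And>i. i < q \<Longrightarrow> 0 \<le> s i"
    and mono: "\<And>i j. i \<le> j \<Longrightarrow> j < q \<Longrightarrow> s j \<le> s i"
    using singular_triples_exist[OF matrix_vector_mul_linear, of q M] by metis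
  have adj: "x i \<bullet> (M *v b) = s i * (b \<bullet> y i)" if "i < q" for i b
    using adjoint_works[OF matrix_vector_mul_linear, of b M "x i"] Mx[OF that]
    by (simp add: inner_commute)
  let ?R = "\<Sum>k<q. s k *\<^sub>R outer (x k) (y k)"
  \<comment> \<open>One of the two families is a full orthonormal basis. If it is the
    \<open>y i\<close>, expand \<open>b\<close> in it; otherwise expand \<open>M *v b\<close> in the
    \<open>x i\<close>, with coefficients read off through the adjoint.\<close>
  have "M *v b = ?R *v b" for b
  proof (cases "q = CARD('n)")
    case True
    then have "b = (\<Sum>i<q. (b \<bullet> y i) *\<^sub>R y i)"
      using orthonormal_expansion[of y b] y by simp
    then have "M *v b = M *v (\<Sum>i<q. (b \<bullet> y i) *\<^sub>R y i)"
      by simp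
    also have "\<dots> = (\<Sum>i<q. (b \<bullet> y i) *\<^sub>R (M *v y i))"
      by (simp add: linear_sum[OF matrix_vector_mul_linear] matrix_vector_mult_scaleR)
    also have "\<dots> = ?R *v b"
      by (simp add: sum_outer_mult_vec My mult_ac)
    finally show ?thesis .
  next
    case False
    then have "q = CARD('m)"
      by (auto simp: q_def min_def split: if_splits)
    then have "M *v b = (\<Sum>i<q. ((M *v b) \<bullet> x i) *\<^sub>R x i)"
      using orthonormal_expansion[of x "M *v b"] x by simp
    also have "\<dots> = ?R *v b"
      unfolding sum_outer_mult_vec
      by (intro sum.cong) (use adj in \<open>auto simp: inner_commute\<close>)
    finally show ?thesis .
  qed
  then have M: "M = ?R"
    by (simp add: matrix_eq)
  \<comment> \<open>Membership in \<open>Delta_plus\<close> demands zeros from \<open>q\<close> on,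
    where the constructed \<open>s\<close> is arbitrary.\<close>
  let ?s = "\<lambda>i. if i < q then s i else 0"
  have "is_svd M ?s x y"
    unfolding is_svd_def q_def[symmetric]
  proof (intro conjI)
    show "?s \<in> Delta_plus q"
      using s0 mono by (auto simp: Delta_plus_def Rvec_def)
    show "M = (\<Sum>k<q. ?s k *\<^sub>R outer (x k) (y k))"
      by (subst M) (intro sum.cong, auto)
  qed (use x y in auto)
  then show ?thesis by blast
qed

lemma is_svd_inner:
  fixes M :: "real^'n^'m"
  assumes "is_svd M s x y" "i < min CARD('m) CARD('n)"
  shows "x i \<bullet> (M *v y i) = s i"
proof -
  define q where "q = min CARD('m) CARD('n)"
  have x: "orthonormal_upto q x" and y: "orthonormal_upto q y"
    and M: "M = (\<Sum>k<q. s k *\<^sub>R outer (x k) (y k))" and i: "i < q"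
    using assms by (simp_all add: is_svd_def q_def)
  have "x i \<bullet> (M *v y i) = (\<Sum>j<q. if j = i then s j else 0)"
    unfolding M form_sum_outer using x y i by (intro sum.cong) (auto simp: orthonormal_upto_def)
  then show ?thesis
    using i by simp
qed

text \<open>The certificate from one decomposition, tested on the vectors of the other, compares
  their partial sums. By symmetry all partial sums agree, and differences of consecutive ones
  recover the entries.\<close>

lemma svd_values_unique:
  fixes M :: "real^'n^'m"
  assumes "is_svd M s x y" "is_svd M s' x' y'"
  shows "s = s'"
proof -
  define q where "q = min CARD('m) CARD('n)"
  have le: "(\<Sum>i<k. s' i) \<le> (\<Sum>i<k. s i)"
    if svd: "is_svd M s x y" and svd': "is_svd M s' x' y'" and k: "k \<le> q" for s s' x x' y y' k
  proof (cases k)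
    case (Suc j)
    have "ky_fan_bound k M (\<Sum>i<k. s i)"
      using svd k ky_fan_bound_sum_outer[of s q x y j] Suc by (simp add: is_svd_def q_def)
    then have "(\<Sum>i<k. x' i \<bullet> (M *v y' i)) \<le> (\<Sum>i<k. s i)"
      by (rule ky_fan_bound_imp_sum_le)
        (use svd' k in \<open>auto simp: is_svd_def q_def intro: orthonormal_upto_mono\<close>)
    moreover have "(\<Sum>i<k. x' i \<bullet> (M *v y' i)) = (\<Sum>i<k. s' i)"
      by (intro sum.cong refl is_svd_inner[OF svd']) (use k in \<open>auto simp: q_def\<close>)
    ultimately show ?thesis by simp
  qed simp
  have sums: "(\<Sum>i<k. s i) = (\<Sum>i<k. s' i)" if "k \<le> q" for k
    using le[OF assms that] le[OF assms(2,1) that] by simp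
  show ?thesis
  proof
    fix i
    show "s i = s' i"
    proof (cases "i < q")
      case True
      then show ?thesis
        using sums[of i] sums[of "Suc i"] by simp
    next
      case False
      moreover have "s \<in> Delta_plus q" "s' \<in> Delta_plus q"
        using assms by (simp_all add: is_svd_def q_def)
      ultimately show ?thesis
        using Delta_plusD(3)[of _ q i] by (metis leI)
    qed
  qed
qed

lemma svals_eqI:
  assumes "is_svd M s x y"
  shows "svals M = s"
proof -
  have "svals M = (THE s. \<exists>x y. is_svd M s x y)"
    unfolding svals_def is_svd_def orthonormal_upto_def
    by (rule arg_cong[where f = The]) (auto simp: fun_eq_iff; blast)
  also have "\<dots> = s"
    using assms svd_values_unique by (intro the_equality) blast+
  finally show ?thesis .
qed

lemma svals_svd:
  obtains x y where "is_svd M (svals M) x y"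
  using svd_exists svals_eqI by metis

text \<open>The \<open>x i\<close> with nonzero value span the range of \<open>M\<close>, so the
  rank counts the nonzero values, which come first in the order.\<close>

lemma rank_le_iff_svals:
  fixes M :: "real^'n^'m"
  shows "rank M \<le> K \<longleftrightarrow> (\<forall>i\<ge>K. svals M i = 0)"
proof -
  define q where "q = min CARD('m) CARD('n)"
  obtain x y where svd: "is_svd M (svals M) x y"
    by (rule svals_svd)
  define s where "s = svals M"
  have s: "s \<in> Delta_plus q" and x: "orthonormal_upto q x" and y: "orthonormal_upto q y"
    and M: "M = (\<Sum>k<q. s k *\<^sub>R outer (x k) (y k))"
    using svd by (auto simp: is_svd_def q_def s_def)
  show ?thesis
    unfolding s_def[symmetric]
  proof
    assume K: "\<forall>i\<ge>K. s i = 0"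
    have "range ((*v) M) \<subseteq> span (x ` {..<K})"
    proof clarify
      fix b
      have "s i * (b \<bullet> y i) = 0 \<or> x i \<in> x ` {..<K}" for i
        using K by (cases "i < K") auto
      then show "M *v b \<in> span (x ` {..<K})"
        unfolding M sum_outer_mult_vec
        by (intro span_sum) (metis scale_zero_left span_base span_scale span_zero)
    qed
    then have "dim (range ((*v) M)) \<le> card (x ` {..<K})"
      by (intro dim_le_card) auto
    also have "\<dots> \<le> K"
      using card_image_le[of "{..<K}" x] by simp
    finally show "rank M \<le> K"
      by (simp add: rank_dim_range)
  next
    assume K: "rank M \<le> K"
    show "\<forall>i\<ge>K. s i = 0"
    proof (rule ccontr)
      assume "\<not> (\<forall>i\<ge>K. s i = 0)"
      then obtain i where i: "K \<le> i" "s i \<noteq> 0"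
        by blast
      then have iq: "i < q"
        using Delta_plusD(3)[OF s, of i] by (meson leI)
      \<comment> \<open>A nonzero value at some index \<ge> \<open>K\<close> forces all of
        \<open>s 0\<close> to \<open>s K\<close> to be positive: \<open>Suc K\<close> orthonormal
        vectors in the range, one too many.\<close>
      have "x j \<in> range ((*v) M)" if "j < Suc K" for j
      proof -
        have j: "j < q" "0 < s j"
          using Delta_plusD(1)[OF s, of j i] Delta_plusD(2)[OF s, of i] i iq that by auto
        have "M *v y j = (\<Sum>l<q. if l = j then s j *\<^sub>R x j else 0)"
          unfolding M sum_outer_mult_vec using y j
          by (intro sum.cong) (auto simp: orthonormal_upto_def)
        then have "M *v (y j /\<^sub>R s j) = x j"
          using j by (simp add: matrix_vector_mult_scaleR)
        then show ?thesis
          by (metis rangeI)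
      qed
      then have "x ` {..<Suc K} \<subseteq> range ((*v) M)"
        by blast
      moreover have "orthonormal_upto (Suc K) x"
        using x i iq by (auto intro: orthonormal_upto_mono)
      ultimately have "Suc K \<le> dim (range ((*v) M))"
        using independent_card_le_dim orthonormal_upto_independent by metis
      with K show False
        by (simp add: rank_dim_range)
    qed
  qed
qed

subsection \<open>Convex hulls of sets given by singular values\<close>

text \<open>All certificate conditions are linear in the matrix, the parameter and \<open>Z\<close>,
  \<open>W\<close>, \<open>s\<close> jointly, so the last three can be projected away. The bound
  depends on a parameter because it will be a partial sum of a variable vector.\<close>

lemma sdr_ky_fan_bound:
  fixes t :: "'p::euclidean_space \<Rightarrow> real"
  assumes "linear t"
  shows "sdr {z :: (real^'n^'m) \<times> 'p. ky_fan_bound k (fst z) (t (snd z))}"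
proof -
  let ?M = "\<lambda>z :: ((real^'n^'m) \<times> 'p) \<times> (real^'m^'m) \<times> (real^'n^'n) \<times> real. fst (fst z)"
  let ?p = "\<lambda>z :: ((real^'n^'m) \<times> 'p) \<times> (real^'m^'m) \<times> (real^'n^'n) \<times> real. snd (fst z)"
  let ?Z = "\<lambda>z :: ((real^'n^'m) \<times> 'p) \<times> (real^'m^'m) \<times> (real^'n^'n) \<times> real. fst (snd z)"
  let ?W = "\<lambda>z :: ((real^'n^'m) \<times> 'p) \<times> (real^'m^'m) \<times> (real^'n^'n) \<times> real. fst (snd (snd z))"
  let ?s = "\<lambda>z :: ((real^'n^'m) \<times> 'p) \<times> (real^'m^'m) \<times> (real^'n^'n) \<times> real. snd (snd (snd z))"
  \<comment> \<open>The inequality coupling \<open>a\<close> and \<open>b\<close> is nonnegativity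
    of a single form on the product space.\<close>
  let ?Q = "\<lambda>z (v :: (real^'m) \<times> (real^'n)) w. fst v \<bullet> (?Z z *v fst w) + snd v \<bullet> (?W z *v snd w)
      + ?s z * (fst v \<bullet> fst w + snd v \<bullet> snd w) - 2 * (fst v \<bullet> (?M z *v snd w))"
  note matrix_simps = matrix_vector_mult_add_rdistrib scaleR_matrix_vector_assoc[symmetric]
    matrix_vector_right_distrib matrix_vector_mult_scaleR inner_add_left inner_add_right
  have 1: "sdr {z. \<forall>a. 0 \<le> a \<bullet> (?Z z *v a)}"
    by (rule sdr_nonneg_form[where Q = "\<lambda>z a b. a \<bullet> (?Z z *v b)"])
      (auto simp: bilinear_matrix_form linear_iff matrix_simps)
  have 2: "sdr {z. \<forall>b. 0 \<le> b \<bullet> (?W z *v b)}"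
    by (rule sdr_nonneg_form[where Q = "\<lambda>z a b. a \<bullet> (?W z *v b)"])
      (auto simp: bilinear_matrix_form linear_iff matrix_simps)
  have 3: "sdr {z. \<forall>v. 0 \<le> ?Q z v v}"
    by (rule sdr_nonneg_form[where Q = ?Q]) (auto simp: bilinear_def linear_iff matrix_simps algebra_simps)
  have trace: "trace (c *\<^sub>R A) = c * trace A" for c :: real and A :: "real^'k^'k"
    by (simp add: trace_def sum_distrib_left)
  have 4: "sdr {z. 0 \<le> 2 * t (?p z) - trace (?Z z) - trace (?W z) - 2 * real k * ?s z}"
    by (rule sdr_nonneg_functional)
      (use assms in \<open>auto simp: linear_iff trace_add trace algebra_simps\<close>)
  let ?S = "{z. \<forall>a. 0 \<le> a \<bullet> (?Z z *v a)} \<inter> {z. \<forall>b. 0 \<le> b \<bullet> (?W z *v b)} \<inter> {z. \<forall>v. 0 \<le> ?Q z v v}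
      \<inter> {z. 0 \<le> 2 * t (?p z) - trace (?Z z) - trace (?W z) - 2 * real k * ?s z}"
  have "sdr {x. \<exists>y. (x, y) \<in> ?S}"
    by (intro sdr_projection sdr_Int 1 2 3 4)
  moreover have "{x. \<exists>y. (x, y) \<in> ?S} = {z :: (real^'n^'m) \<times> 'p. ky_fan_bound k (fst z) (t (snd z))}"
    unfolding ky_fan_bound_def by (intro Collect_cong) (simp add: algebra_simps)
  ultimately show ?thesis by simp
qed

text \<open>A closed subset of a product of unit balls, compact by Tychonoff. The entries from
  \<open>k\<close> on are pinned to zero since free entries would be unbounded.\<close>

lemma compact_orthonormal_upto:
  "compact {x :: nat \<Rightarrow> 'a::euclidean_space. orthonormal_upto k x \<and> (\<forall>i\<ge>k. x i = 0)}"
proof -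
  have "compactin (product_topology (\<lambda>_. euclidean) UNIV) (PiE UNIV (\<lambda>_ :: nat. cball (0 :: 'a) 1))"
    by (simp add: compactin_PiE)
  then have "compact (PiE UNIV (\<lambda>_ :: nat. cball (0 :: 'a) 1))"
    by (simp add: euclidean_product_topology)
  moreover have "closed {x :: nat \<Rightarrow> 'a. orthonormal_upto k x \<and> (\<forall>i\<ge>k. x i = 0)}"
    unfolding orthonormal_upto_def
    by (intro closed_Collect_conj closed_Collect_all closed_Collect_imp open_Collect_const
        closed_Collect_eq continuous_intros continuous_on_product_coordinates)
  ultimately have "compact (PiE UNIV (\<lambda>_ :: nat. cball (0 :: 'a) 1)
      \<inter> {x. orthonormal_upto k x \<and> (\<forall>i\<ge>k. x i = 0)})"
    by (rule compact_Int_closed)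
  moreover have "norm (x i) \<le> 1" if "orthonormal_upto k x" "\<forall>i\<ge>k. x i = 0" for x :: "nat \<Rightarrow> 'a" and i
    using that by (cases "i < k") (auto simp: orthonormal_upto_def norm_eq_sqrt_inner)
  then have "PiE UNIV (\<lambda>_ :: nat. cball (0 :: 'a) 1) \<inter> {x. orthonormal_upto k x \<and> (\<forall>i\<ge>k. x i = 0)}
      = {x. orthonormal_upto k x \<and> (\<forall>i\<ge>k. x i = 0)}"
    by auto
  ultimately show ?thesis by simp
qed

lemma compact_prescribed_svals:
  "compact {M :: real^'n^'m. \<exists>x y. is_svd M u x y}"
proof (cases "u \<in> Delta_plus (min CARD('m) CARD('n))")
  case True
  define q where "q = min CARD('m) CARD('n)"
  let ?A = "{x :: nat \<Rightarrow> real^'m. orthonormal_upto q x \<and> (\<forall>i\<ge>q. x i = 0)}"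
  let ?B = "{y :: nat \<Rightarrow> real^'n. orthonormal_upto q y \<and> (\<forall>i\<ge>q. y i = 0)}"
  let ?f = "\<lambda>p. \<Sum>k<q. u k *\<^sub>R outer (fst p k :: real^'m) (snd p k :: real^'n)"
  have "continuous_on (?A \<times> ?B) (\<lambda>p. outer (fst p k) (snd p k))" for k
  proof -
    have "continuous_on (?A \<times> ?B) (\<lambda>p. fst p k)" "continuous_on (?A \<times> ?B) (\<lambda>p. snd p k)"
      by (rule continuous_on_product_then_coordinatewise[OF continuous_on_fst[OF continuous_on_id]]
          continuous_on_product_then_coordinatewise[OF continuous_on_snd[OF continuous_on_id]])+
    then show ?thesis
      unfolding outer_def
      by (intro continuous_on_vec_lambda continuous_on_mult continuous_on_component)
  qed
  then have "compact (?f ` (?A \<times> ?B))"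
    by (intro compact_continuous_image continuous_intros compact_Times compact_orthonormal_upto)
  moreover have "?f ` (?A \<times> ?B) = {M :: real^'n^'m. \<exists>x y. is_svd M u x y}"
  proof (intro equalityI subsetI)
    fix M :: "real^'n^'m" assume "M \<in> {M. \<exists>x y. is_svd M u x y}"
    then obtain x y where "is_svd M u x y"
      by blast
    \<comment> \<open>Zeroing the vectors from \<open>q\<close> on does not affect the sum and
      brings the families into the compact sets.\<close>
    then have "M = ?f (\<lambda>i. if i < q then x i else 0, \<lambda>i. if i < q then y i else 0)"
      "(\<lambda>i. if i < q then x i else 0, \<lambda>i. if i < q then y i else 0) \<in> ?A \<times> ?B"
      by (auto simp: is_svd_def q_def[symmetric] orthonormal_upto_def)
    then show "M \<in> ?f ` (?A \<times> ?B)"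
      by (rule image_eqI)
  next
    fix M assume "M \<in> ?f ` (?A \<times> ?B)"
    then obtain p where "p \<in> ?A \<times> ?B" "M = ?f p"
      by blast
    then have "is_svd M u (fst p) (snd p)"
      using True by (auto simp: is_svd_def q_def)
    then show "M \<in> {M. \<exists>x y. is_svd M u x y}"
      by blast
  qed
  ultimately show ?thesis by simp
qed (simp add: is_svd_def)

lemma abel_sum_mono:
  fixes c a b :: "nat \<Rightarrow> real"
  assumes c: "c \<in> Delta_plus q" and le: "\<And>k. k < q \<Longrightarrow> (\<Sum>i<Suc k. a i) \<le> (\<Sum>i<Suc k. b i)"
  shows "(\<Sum>i<q. c i * a i) \<le> (\<Sum>i<q. c i * b i)"
proof (cases q)
  case (Suc n)
  \<comment> \<open>Summation by parts as an induction: the accumulated difference is nonnegative,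
    so replacing its weight by the next, smaller coefficient only decreases it.\<close>
  have "c k * (\<Sum>i<Suc k. b i - a i) \<le> (\<Sum>i<Suc k. c i * (b i - a i))" if "k < q" for k
    using that
  proof (induction k)
    case (Suc k)
    have "0 \<le> (\<Sum>i<Suc k. b i - a i)"
      using le[of k] Suc.prems by (simp add: sum_subtractf)
    then have "c (Suc k) * (\<Sum>i<Suc k. b i - a i) \<le> c k * (\<Sum>i<Suc k. b i - a i)"
      using Delta_plusD(1)[OF c, of k "Suc k"] Suc.prems by (intro mult_right_mono) auto
    also have "\<dots> \<le> (\<Sum>i<Suc k. c i * (b i - a i))"
      using Suc by simp
    finally show ?case
      by (simp add: algebra_simps)
  qed simp
  from this[of n] have "c n * (\<Sum>i<q. b i - a i) \<le> (\<Sum>i<q. c i * (b i - a i))"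
    by (simp only: Suc lessI)
  moreover have "0 \<le> c n * (\<Sum>i<q. b i - a i)"
    using le[of n] Delta_plusD(2)[OF c, of n] Suc by (simp add: sum_subtractf)
  ultimately show ?thesis
    by (simp add: algebra_simps sum_subtractf)
qed simp

lemma ky_fan_bounds_imp_convex_hull:
  fixes M :: "real^'n^'m"
  assumes u: "u \<in> Delta_plus (min CARD('m) CARD('n))"
    and bound: "\<And>k. k < min CARD('m) CARD('n) \<Longrightarrow> ky_fan_bound (Suc k) M (\<Sum>i<Suc k. u i)"
  shows "M \<in> convex hull {P. svals P = u}"
proof (rule ccontr)
  define q where "q = min CARD('m) CARD('n)"
  let ?S = "{P :: real^'n^'m. svals P = u}"
  assume M: "M \<notin> convex hull ?S"
  have "?S = {P. \<exists>x y. is_svd P u x y}"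
    using svals_eqI svals_svd by blast
  \<comment> \<open>Strict separation of a point needs a closed set; in finite dimension the hull of
    a compact set is compact.\<close>
  then have "closed (convex hull ?S)"
    by (simp add: compact_imp_closed compact_convex_hull compact_prescribed_svals)
  then obtain C b where C: "C \<bullet> M < b" "\<And>P. P \<in> convex hull ?S \<Longrightarrow> C \<bullet> P > b"
    using separating_hyperplane_closed_point[OF convex_convex_hull _ M] by blast
  \<comment> \<open>The hyperplane leaves \<open>M\<close> on the low side of \<open>C\<close>, so
    the functional that is too large at \<open>M\<close> is \<open>- C\<close>.\<close>
  obtain s x y where "is_svd (- C) s x y"
    using svd_exists by blast
  then have s: "s \<in> Delta_plus q" and x: "orthonormal_upto q x" and y: "orthonormal_upto q y"
    and C_eq: "- C = (\<Sum>k<q. s k *\<^sub>R outer (x k) (y k))"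
    by (simp_all add: is_svd_def q_def)
  have inner_C: "- C \<bullet> P = (\<Sum>k<q. s k * (x k \<bullet> (P *v y k)))" for P
    unfolding C_eq by (simp add: inner_sum_left inner_outer)
  \<comment> \<open>Aligning \<open>u\<close> with the singular vectors of \<open>- C\<close> makes
    the pairing with \<open>- C\<close> equal to \<open>\<Sum> s k * u k\<close>, the bound that the
    Ky Fan inequalities give for \<open>M\<close>.\<close>
  define P where "P = (\<Sum>k<q. u k *\<^sub>R outer (x k) (y k))"
  have P: "is_svd P u x y"
    using u x y by (simp add: is_svd_def P_def q_def)
  have "- C \<bullet> M \<le> (\<Sum>k<q. s k * u k)"
    unfolding inner_C
  proof (rule abel_sum_mono[OF s])
    fix k assume k: "k < q"
    show "(\<Sum>i<Suc k. x i \<bullet> (M *v y i)) \<le> (\<Sum>i<Suc k. u i)"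
      using k by (intro ky_fan_bound_imp_sum_le bound orthonormal_upto_mono[OF x]
          orthonormal_upto_mono[OF y]) (auto simp: q_def)
  qed
  also have "\<dots> = - C \<bullet> P"
    unfolding inner_C by (intro sum.cong refl) (simp add: is_svd_inner[OF P] q_def)
  finally have "C \<bullet> P \<le> C \<bullet> M"
    by simp
  moreover have "C \<bullet> P > b"
    by (intro C(2) hull_inc) (simp add: svals_eqI[OF P])
  ultimately show False
    using C(1) by simp
qed

theorem mainTheorem11:
  fixes f :: "(nat \<Rightarrow> real) \<Rightarrow> real" and r :: real and K :: nat
  assumes "K > 0"
    and "\<And>t. sdr_vec (min CARD('m::finite) CARD('n::finite))
                {u \<in> Delta_plus (min CARD('m) CARD('n)). f u \<le> t}"
  shows "sdr (convex hull {M :: real^'n^'m. rank M \<le> K \<and> f (svals M) \<le> r})"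
proof -
  define q where "q = min CARD('m) CARD('n)"
  define D where "D = {u \<in> Delta_plus q. f u \<le> r}"
  let ?S = "{M :: real^'n^'m. rank M \<le> K \<and> f (svals M) \<le> r}"
  obtain g where g: "bij_betw g {..<CARD('m)} (UNIV :: 'm set)"
    by (metis ex_bij_betw_nat_finite finite atLeast0LessThan)
  \<comment> \<open>No type has dimension \<open>q\<close>, so vectors of length \<open>q\<close> are coordinates of vectors in \<open>real^'m\<close>.\<close>
  define \<phi> where "\<phi> w i = (if i < q then w $ g i else 0)" for w :: "real^'m" and i
  have lin: "linear (\<lambda>w. \<phi> w i)" for i
    by (auto simp: \<phi>_def linear_iff)
  have \<phi>_surj: "\<exists>w. \<phi> w = u" if "u \<in> Delta_plus q" for u
  proof
    show "\<phi> (\<chi> j. u (the_inv_into {..<CARD('m)} g j)) = u"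
    proof
      fix i
      have "the_inv_into {..<CARD('m)} g (g i) = i" if "i < q"
        using that bij_betw_imp_inj_on[OF g] by (intro the_inv_into_f_f) (auto simp: q_def)
      then show "\<phi> (\<chi> j. u (the_inv_into {..<CARD('m)} g j)) i = u i"
        using Delta_plusD(3)[OF \<open>u \<in> Delta_plus q\<close>, of i] by (simp add: \<phi>_def)
    qed
  qed
  \<comment> \<open>The lifted set: the vector \<open>u\<close> is an extra variable, constrained by
    \<open>D\<close> and by the rank condition. Only the Ky Fan bounds couple it to the matrix.
    Entries from \<open>q\<close> on vanish by the choice of \<open>\<phi>\<close>, so the rank
    condition stops at \<open>q\<close>.\<close>
  define T where "T = {z :: (real^'n^'m) \<times> (real^'m). \<phi> (snd z) \<in> D}
      \<inter> (\<Inter>i\<in>{K..<q}. {z. \<phi> (snd z) i = 0})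
      \<inter> (\<Inter>k\<in>{..<q}. {z. ky_fan_bound (Suc k) (fst z) (\<Sum>i<Suc k. \<phi> (snd z) i)})"
  have lin': "linear (\<lambda>z :: (real^'n^'m) \<times> (real^'m). \<phi> (snd z) i)" for i
    using lin by (simp add: linear_iff)
  have "sdr T"
    unfolding T_def
  proof (intro sdr_Int sdr_INT)
    show "sdr {z :: (real^'n^'m) \<times> (real^'m). \<phi> (snd z) \<in> D}"
    proof (rule sdr_linear_vimage_sdr_vec)
      show "sdr_vec q D"
        using assms(2) by (simp add: D_def q_def)
      show "\<phi> (snd z) \<in> Rvec q" for z :: "(real^'n^'m) \<times> (real^'m)"
        by (simp add: \<phi>_def Rvec_def)
    qed (rule lin')
    show "sdr {z :: (real^'n^'m) \<times> (real^'m). \<phi> (snd z) i = 0}" for i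
      using lin' by (rule sdr_kernel)
    show "sdr {z :: (real^'n^'m) \<times> (real^'m). ky_fan_bound (Suc k) (fst z) (\<Sum>i<Suc k. \<phi> (snd z) i)}" for k
      by (intro sdr_ky_fan_bound linear_compose_sum ballI lin)
  qed auto
  then have sdr: "sdr {M. \<exists>w. (M, w) \<in> T}"
    by (rule sdr_projection)
  have "convex hull ?S = {M. \<exists>w. (M, w) \<in> T}"
  proof
    show "convex hull ?S \<subseteq> {M. \<exists>w. (M, w) \<in> T}"
    proof (rule hull_minimal)
      show "convex {M. \<exists>w. (M, w) \<in> T}"
        using sdr by (rule sdr_convex)
      show "?S \<subseteq> {M. \<exists>w. (M, w) \<in> T}"
      proof clarify
        fix M :: "real^'n^'m" assume M: "rank M \<le> K" "f (svals M) \<le> r"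
        obtain x y where "is_svd M (svals M) x y"
          by (rule svals_svd)
        then have u: "svals M \<in> Delta_plus q" and x: "orthonormal_upto q x"
          and y: "orthonormal_upto q y" and M_eq: "M = (\<Sum>k<q. svals M k *\<^sub>R outer (x k) (y k))"
          by (simp_all add: is_svd_def q_def)
        obtain w where w: "\<phi> w = svals M"
          using \<phi>_surj[OF u] by blast
        \<comment> \<open>A matrix of the original set is lifted with its own singular values, for
          which every Ky Fan bound is attained.\<close>
        have "ky_fan_bound (Suc k) M (\<Sum>i<Suc k. svals M i)" if "k < q" for k
          using ky_fan_bound_sum_outer[OF u x y that] M_eq by simp
        then show "\<exists>w. (M, w) \<in> T"
          using M u rank_le_iff_svals[of M K] by (intro exI[of _ w]) (simp add: T_def w D_def)
      qed
    qed
    show "{M. \<exists>w. (M, w) \<in> T} \<subseteq> convex hull ?S"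
    proof clarify
      fix M w assume T: "(M, w) \<in> T"
      let ?u = "\<phi> w"
      have u: "?u \<in> Delta_plus q" "f ?u \<le> r" and K: "\<forall>i\<ge>K. ?u i = 0"
        using T by (auto simp: T_def D_def \<phi>_def)
      have "M \<in> convex hull {P. svals P = ?u}"
        using T u(1) by (intro ky_fan_bounds_imp_convex_hull) (auto simp: T_def q_def)
      \<comment> \<open>Both defining conditions depend on singular values alone, so every matrix
        with values \<open>?u\<close> belongs to the original set.\<close>
      also have "\<dots> \<subseteq> convex hull ?S"
        using u(2) K by (intro hull_mono) (auto simp: rank_le_iff_svals)
      finally show "M \<in> convex hull ?S" .
    qed
  qed
  with sdr show ?thesis
    by simp
qed

end
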